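(* Let $m,J>0$ and $a,b\in\mathbb R$. The equations of the discrete Chaplygin sleigh $$p_{\theta,k+1}=p_{\theta,k}-2am\,V_{2,k},\qquad p_{1,k+1}=p_{1,k}+2am\,(1-\cos\Delta\theta_k)$$ preserve the quantity $$E=m\,p_\theta^2+2bm\,p_\theta p_1+(J+m(a^2+b^2))\,p_1^2,$$ that is, $E(p_{\theta,k+1},p_{1,k+1})=E(p_{\theta,k},p_{1,k})$. This quantity coincides with the constrained energy integral of the continuous Chaplygin sleigh.
   Context: The state of the discrete sleigh at step $k$ is given by $(\Delta\theta_k,V_{1,k},V_{2,k})$, the coordinates of an incremental displacement in $SE(2)$ (rotation angle $\Delta\theta_k$, translation $(V_{1,k},V_{2,k})$ in the body frame), subject to the discrete constraint $$-V_{1,k}\sin(\Delta\theta_k/2)+V_{2,k}\cos(\Delta\theta_k/2)=0,$$ which implies $V_{1,k}(1-\cos\Delta\theta_k)-V_{2,k}\sin\Delta\theta_k=0$. The discrete body momenta are $$p_{\theta,k}=(J+ma^2+mb^2)\sin\Delta\theta_k+am\,V_{2,k}-bm\,V_{1,k},$$ $$p_{1,k}=m\,V_{1,k}-am(1-\cos\Delta\theta_k)-bm\sin\Delta\theta_k.$$ The equations define a (multi-valued) map: given $(\Delta\theta_k,V_{1,k},V_{2,k})$, compute $p_{\theta,k},p_{1,k}$, then $p_{\theta,k+1},p_{1,k+1}$, then choose $(\Delta\theta_{k+1},V_{1,k+1},V_{2,k+1})$ satisfying the constraint and having these momenta. The continuous Chaplygin sleigh is described by $$\dot p_\theta=-\frac{a}{(J+ma^2)^2}(p_\theta+bp_1)\big(mb\,p_\theta+(J+m(a^2+b^2))p_1\big),\qquad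 \dot p_1=\frac{ma}{(J+ma^2)^2}(p_\theta+bp_1)^2,$$ and its constrained energy integral is $m p_\theta^2+2bm\,p_\theta p_1+(J+m(a^2+b^2))p_1^2$. *)

theory Defs
  imports "HOL-Analysis.Analysis"
begin

text \<open>
  A state of the discrete sleigh is a triple \<open>(\<theta>, V1, V2)\<close>: the rotation angle \<open>\<Delta>\<theta>\<close> and the
  translation in the body frame of an incremental displacement in \<open>SE(2)\<close>. The angle is
  represented by a real number. Momenta are pairs \<open>(p_\<theta>, p_1)\<close>. The parameters of the sleigh
  are always listed in the order \<open>m J a b\<close>.
\<close>

type_synonym sleigh_state = "real \<times> real \<times> real"
type_synonym sleigh_momentum = "real \<times> real"

definition discrete_sleigh_constraint :: "sleigh_state \<Rightarrow> bool" where
  "discrete_sleigh_constraint = (\<lambda>(\<theta>, V1, V2).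
     - V1 * sin (\<theta> / 2) + V2 * cos (\<theta> / 2) = 0)"

definition discrete_sleigh_momentum ::
  "real \<Rightarrow> real \<Rightarrow> real \<Rightarrow> real \<Rightarrow> sleigh_state \<Rightarrow> sleigh_momentum" where
  "discrete_sleigh_momentum m J a b = (\<lambda>(\<theta>, V1, V2).
     ((J + m * a^2 + m * b^2) * sin \<theta> + a * m * V2 - b * m * V1,
      m * V1 - a * m * (1 - cos \<theta>) - b * m * sin \<theta>))"

text \<open>
  The momentum at step \<open>k + 1\<close> as determined by the state at step \<open>k\<close>, whether or not a state
  having that momentum exists.
\<close>

definition discrete_sleigh_next_momentum ::
  "real \<Rightarrow> real \<Rightarrow> real \<Rightarrow> real \<Rightarrow> sleigh_state \<Rightarrow> sleigh_momentum" where
  "discrete_sleigh_next_momentum m J a b = (\<lambda>(\<theta>, V1, V2).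
     (fst (discrete_sleigh_momentum m J a b (\<theta>, V1, V2)) - 2 * a * m * V2,
      snd (discrete_sleigh_momentum m J a b (\<theta>, V1, V2)) + 2 * a * m * (1 - cos \<theta>)))"

text \<open>The multi-valued evolution map, as the set of all admissible successor states.\<close>

definition discrete_sleigh_map ::
  "real \<Rightarrow> real \<Rightarrow> real \<Rightarrow> real \<Rightarrow> sleigh_state \<Rightarrow> sleigh_state set" where
  "discrete_sleigh_map m J a b x =
     {x'. discrete_sleigh_constraint x' \<and>
          discrete_sleigh_momentum m J a b x' = discrete_sleigh_next_momentum m J a b x}"

definition discrete_sleigh_E ::
  "real \<Rightarrow> real \<Rightarrow> real \<Rightarrow> real \<Rightarrow> sleigh_momentum \<Rightarrow> real" where
  "discrete_sleigh_E m J a b = (\<lambda>(p\<theta>, p1).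
     m * p\<theta>^2 + 2 * b * m * p\<theta> * p1 + (J + m * (a^2 + b^2)) * p1^2)"

text \<open>
  Solutions of the continuous Chaplygin sleigh on a set \<open>T\<close> of times (meant to be an interval;
  derivatives at endpoints belonging to \<open>T\<close> are one-sided).
\<close>

definition continuous_sleigh_solution ::
  "real \<Rightarrow> real \<Rightarrow> real \<Rightarrow> real \<Rightarrow> real set \<Rightarrow> (real \<Rightarrow> sleigh_momentum) \<Rightarrow> bool" where
  "continuous_sleigh_solution m J a b T p \<longleftrightarrow>
     (\<forall>t\<in>T.
        ((\<lambda>s. fst (p s)) has_real_derivative
           - (a / (J + m * a^2)^2) * (fst (p t) + b * snd (p t)) *
             (m * b * fst (p t) + (J + m * (a^2 + b^2)) * snd (p t))) (at t within T) \<and>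
        ((\<lambda>s. snd (p s)) has_real_derivative
           (m * a / (J + m * a^2)^2) * (fst (p t) + b * snd (p t))^2) (at t within T))"

text \<open>
  The constrained energy of the continuous sleigh as a function of the momenta, in the
  normalization without the constant factor \<open>1 / (2 m (J + m a\<^sup>2))\<close>.
\<close>

definition continuous_sleigh_constrained_energy ::
  "real \<Rightarrow> real \<Rightarrow> real \<Rightarrow> real \<Rightarrow> sleigh_momentum \<Rightarrow> real" where
  "continuous_sleigh_constrained_energy m J a b = (\<lambda>(p\<theta>, p1).
     m * p\<theta>^2 + 2 * b * m * p\<theta> * p1 + (J + m * (a^2 + b^2)) * p1^2)"

definition continuous_sleigh_integral ::
  "real \<Rightarrow> real \<Rightarrow> real \<Rightarrow> real \<Rightarrow> (sleigh_momentum \<Rightarrow> real) \<Rightarrow> bool" where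
  "continuous_sleigh_integral m J a b F \<longleftrightarrow>
     (\<forall>T p. is_interval T \<and> continuous_sleigh_solution m J a b T p \<longrightarrow>
        (\<forall>s\<in>T. \<forall>t\<in>T. F (p s) = F (p t)))"

end

theory Submission
  imports Defs
begin

text \<open>
  Write \<open>I = J + m a\<^sup>2\<close> and \<open>u = p\<^sub>\<theta> + b p\<^sub>1\<close>. Completing the square diagonalizes the energy:
  \<open>E = m u\<^sup>2 + I p\<^sub>1\<^sup>2\<close>. Both conservation laws become transparent in these coordinates.

  In the discrete system, the update of the momenta only flips the sign of the terms that carry a
  bare factor \<open>a\<close>; equivalently, it replaces \<open>a\<close> by \<open>-a\<close> in the momentum map, and \<open>I\<close> does not
  notice this. With \<open>c = 1 - cos \<theta>\<close> the momenta before and after the step are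
  \<open>u = I sin \<theta> + \<sigma> a m (V\<^sub>2 - b c)\<close> and \<open>p\<^sub>1 = m (V\<^sub>1 - b sin \<theta>) - \<sigma> a m c\<close>
  with \<open>\<sigma> = 1\<close> before and \<open>\<sigma> = -1\<close> after.
  Hence the change of \<open>E\<close> consists of cross terms only, and these add up to
  \<open>4 a m\<^sup>2 I (V\<^sub>1 c - V\<^sub>2 sin \<theta>)\<close>. The bracket is a multiple of the constraint, by the half-angle
  formulas.

  In the continuous system, the equations of motion read \<open>u' = - (a / I) u p\<^sub>1\<close> and
  \<open>p\<^sub>1' = (m a / I\<^sup>2) u\<^sup>2\<close>, so the two contributions \<open>2 m u u'\<close> and \<open>2 I p\<^sub>1 p\<^sub>1'\<close> to \<open>E'\<close> cancel,
  and a function with zero derivative on an interval is constant.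
\<close>

lemma discrete_sleigh_E_sum_of_squares:
  "discrete_sleigh_E m J a b (p\<theta>, p1) = m * (p\<theta> + b * p1)^2 + (J + m * a^2) * p1^2"
  by (simp add: discrete_sleigh_E_def power2_eq_square algebra_simps)

text \<open>
  Multiplying the constraint by \<open>2 sin (\<theta> / 2)\<close> replaces the half angle by the full angle. The
  factor may vanish, so the converse fails.
\<close>

lemma discrete_sleigh_constraint_full_angle:
  assumes "discrete_sleigh_constraint (\<theta>, V1, V2)"
  shows "V1 * (1 - cos \<theta>) - V2 * sin \<theta> = 0"
proof -
  have "sin \<theta> = 2 * sin (\<theta> / 2) * cos (\<theta> / 2)" and "cos \<theta> = 1 - 2 * (sin (\<theta> / 2))^2"
    using sin_double[of "\<theta> / 2"] cos_double_sin[of "\<theta> / 2"] by simp_all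
  then have "V1 * (1 - cos \<theta>) - V2 * sin \<theta>
      = - 2 * sin (\<theta> / 2) * (- V1 * sin (\<theta> / 2) + V2 * cos (\<theta> / 2))"
    by (simp only:) (simp add: power2_eq_square algebra_simps)
  then show ?thesis
    using assms by (simp add: discrete_sleigh_constraint_def)
qed

text \<open>
  The momenta after the step are those that the same displacement would give to a sleigh with the
  opposite offset \<open>-a\<close>. The quadratic form \<open>E\<close> depends on \<open>a\<close> only through \<open>a\<^sup>2\<close>, so it treats both
  sleighs alike.
\<close>

lemma discrete_sleigh_next_momentum_reflection:
  "discrete_sleigh_next_momentum m J a b x = discrete_sleigh_momentum m J (- a) b x"
  by (cases x) (simp add: discrete_sleigh_next_momentum_def discrete_sleigh_momentum_def
      algebra_simps)

text \<open>
  Off the constraint, the energy changes by a multiple of the defect of the full-angle constraint.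
  Squares of the sign-flipped terms cancel in the difference; what remains are the cross terms,
  whose \<open>b\<close>-dependent parts cancel as well.
\<close>

lemma discrete_sleigh_energy_change:
  "discrete_sleigh_E m J a b (discrete_sleigh_next_momentum m J a b (\<theta>, V1, V2))
   - discrete_sleigh_E m J a b (discrete_sleigh_momentum m J a b (\<theta>, V1, V2))
   = 4 * a * m^2 * (J + m * a^2) * (V1 * (1 - cos \<theta>) - V2 * sin \<theta>)"
  unfolding discrete_sleigh_next_momentum_reflection
  by (simp add: discrete_sleigh_momentum_def discrete_sleigh_E_sum_of_squares
      power2_eq_square algebra_simps)

lemma discrete_sleigh_E_preserved:
  assumes "discrete_sleigh_constraint x"
  shows "discrete_sleigh_E m J a b (discrete_sleigh_next_momentum m J a b x)
       = discrete_sleigh_E m J a b (discrete_sleigh_momentum m J a b x)"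
proof (cases x)
  case (fields \<theta> V1 V2)
  then show ?thesis
    using assms discrete_sleigh_constraint_full_angle[of \<theta> V1 V2]
      discrete_sleigh_energy_change[of m J a b \<theta> V1 V2]
    by simp
qed

lemma discrete_sleigh_E_eq_constrained_energy:
  "discrete_sleigh_E m J a b = continuous_sleigh_constrained_energy m J a b"
  by (simp add: discrete_sleigh_E_def continuous_sleigh_constrained_energy_def)

text \<open>
  In the coordinates \<open>u\<close> and \<open>p\<^sub>1\<close> the equations of motion lose all dependence on \<open>b\<close>, and the
  cancellation in the derivative of \<open>m u\<^sup>2 + I p\<^sub>1\<^sup>2\<close> is immediate.
\<close>

lemma continuous_sleigh_energy_derivative:
  assumes sol: "continuous_sleigh_solution m J a b T p" and t: "t \<in> T"
    and nz: "J + m * a^2 \<noteq> 0"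
  shows "((\<lambda>s. discrete_sleigh_E m J a b (p s)) has_real_derivative 0) (at t within T)"
proof -
  define I where "I = J + m * a^2"
  define u where "u = (\<lambda>s. fst (p s) + b * snd (p s))"
  define q where "q = (\<lambda>s. snd (p s))"
  have I: "I \<noteq> 0"
    using nz by (simp add: I_def)
  have fst': "((\<lambda>s. fst (p s)) has_real_derivative
      - (a / I^2) * u t * (m * b * fst (p t) + (J + m * (a^2 + b^2)) * q t)) (at t within T)"
    and q': "(q has_real_derivative (m * a / I^2) * (u t)^2) (at t within T)"
    using sol t by (simp_all add: continuous_sleigh_solution_def I_def u_def q_def)
  have "(u has_real_derivative
      - (a / I^2) * u t * (m * b * fst (p t) + (J + m * (a^2 + b^2)) * q t)
      + b * ((m * a / I^2) * (u t)^2)) (at t within T)"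
    unfolding u_def using DERIV_add[OF fst' DERIV_cmult[OF q', of b]]
    by (simp add: u_def q_def)
  \<comment> \<open>The second factor of the equation for \<open>p\<^sub>\<theta>\<close> is \<open>m b u + I p\<^sub>1\<close>, and the equation for \<open>p\<^sub>1\<close>
    cancels its first summand.\<close>
  also have "- (a / I^2) * u t * (m * b * fst (p t) + (J + m * (a^2 + b^2)) * q t)
      + b * ((m * a / I^2) * (u t)^2) = - (a / I) * u t * q t"
  proof -
    have "m * b * fst (p t) + (J + m * (a^2 + b^2)) * q t = m * b * u t + I * q t"
      by (simp add: I_def u_def q_def power2_eq_square algebra_simps)
    then show ?thesis
      using I by (simp add: field_simps power2_eq_square)
  qed
  finally have u': "(u has_real_derivative - (a / I) * u t * q t) (at t within T)" .
  have "((\<lambda>s. m * (u s)^2 + I * (q s)^2) has_real_derivative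
      m * (2 * u t * (- (a / I) * u t * q t)) + I * (2 * q t * ((m * a / I^2) * (u t)^2)))
      (at t within T)"
    by (auto intro!: derivative_eq_intros u' q' simp: algebra_simps)
  also have "m * (2 * u t * (- (a / I) * u t * q t)) + I * (2 * q t * ((m * a / I^2) * (u t)^2))
      = 0"
    using I by (simp add: divide_simps) (simp add: power2_eq_square algebra_simps)
  also have "(\<lambda>s. m * (u s)^2 + I * (q s)^2) = (\<lambda>s. discrete_sleigh_E m J a b (p s))"
  proof
    fix s
    show "m * (u s)^2 + I * (q s)^2 = discrete_sleigh_E m J a b (p s)"
      using discrete_sleigh_E_sum_of_squares[of m J a b "fst (p s)" "snd (p s)"]
      by (simp add: u_def q_def I_def)
  qed
  finally show ?thesis .
qed

lemma continuous_sleigh_E_integral: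
  assumes "J + m * a^2 \<noteq> 0"
  shows "continuous_sleigh_integral m J a b (discrete_sleigh_E m J a b)"
  unfolding continuous_sleigh_integral_def
proof (intro allI impI ballI)
  fix T p s t
  assume T: "is_interval T \<and> continuous_sleigh_solution m J a b T p" and "s \<in> T" "t \<in> T"
  have "\<exists>c. \<forall>r\<in>T. discrete_sleigh_E m J a b (p r) = c"
    by (rule has_field_derivative_zero_constant)
      (use T assms in \<open>auto intro: is_interval_convex continuous_sleigh_energy_derivative\<close>)
  then show "discrete_sleigh_E m J a b (p s) = discrete_sleigh_E m J a b (p t)"
    using \<open>s \<in> T\<close> \<open>t \<in> T\<close> by auto
qed

theorem theorem7p3:
  fixes m J a b :: real
  assumes "m > 0" and "J > 0"
  shows
    "(\<forall>x. discrete_sleigh_constraint x \<longrightarrow>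
        discrete_sleigh_E m J a b (discrete_sleigh_next_momentum m J a b x) =
        discrete_sleigh_E m J a b (discrete_sleigh_momentum m J a b x)) \<and>
     (\<forall>x x'. discrete_sleigh_constraint x \<and> x' \<in> discrete_sleigh_map m J a b x \<longrightarrow>
        discrete_sleigh_E m J a b (discrete_sleigh_momentum m J a b x') =
        discrete_sleigh_E m J a b (discrete_sleigh_momentum m J a b x)) \<and>
     discrete_sleigh_E m J a b = continuous_sleigh_constrained_energy m J a b \<and>
     continuous_sleigh_integral m J a b (continuous_sleigh_constrained_energy m J a b)"
proof (intro conjI allI impI)
  fix x
  assume "discrete_sleigh_constraint x"
  then show "discrete_sleigh_E m J a b (discrete_sleigh_next_momentum m J a b x)
      = discrete_sleigh_E m J a b (discrete_sleigh_momentum m J a b x)"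
    by (rule discrete_sleigh_E_preserved)
next
  fix x x'
  assume "discrete_sleigh_constraint x \<and> x' \<in> discrete_sleigh_map m J a b x"
  then show "discrete_sleigh_E m J a b (discrete_sleigh_momentum m J a b x')
      = discrete_sleigh_E m J a b (discrete_sleigh_momentum m J a b x)"
    by (simp add: discrete_sleigh_map_def discrete_sleigh_E_preserved)
next
  show "discrete_sleigh_E m J a b = continuous_sleigh_constrained_energy m J a b"
    by (rule discrete_sleigh_E_eq_constrained_energy)
next
  have "J + m * a^2 > 0"
    using assms by (simp add: add_pos_nonneg)
  then show "continuous_sleigh_integral m J a b (continuous_sleigh_constrained_energy m J a b)"
    using continuous_sleigh_E_integral[of J m a b]
    by (simp add: discrete_sleigh_E_eq_constrained_energy)
qed

end
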